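(* (a) For $t\ge 3$ and $1\le n_1\le\cdots\le n_t$, $crx_1(K_{n_1,\dots,n_t})=3$. (b) For all $k,t\ge 2$ there exists $N=N(k,t)$ such that $crx_k(K_{t\times n})=2k$ for all $n\ge N$.
   Context: $K_{n_1,\dots,n_t}$ is the complete $t$-partite graph with class sizes $n_1,\dots,n_t$, and $K_{t\times n}$ is the complete $t$-partite graph with every class of size $n$. An edge-coloured cycle is rainbow if its edges have distinct colours. For a graph $G$ in which any $k$ vertices lie on a common cycle, $crx_k(G)$ is the minimum number of colours in an edge-colouring of $G$ such that every set of $k$ vertices of $G$ lies in some rainbow cycle. *)

theory Defs
  imports Main
begin

text \<open>A graph is given by a vertex set V and a symmetric irreflexive adjacency relation E.\<close>

definition graph_edges :: "'a set \<Rightarrow> ('a \<Rightarrow> 'a \<Rightarrow> bool) \<Rightarrow> 'a set set" where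
  "graph_edges V E = {{u, v} | u v. u \<in> V \<and> v \<in> V \<and> E u v}"

definition is_cycle :: "'a set \<Rightarrow> ('a \<Rightarrow> 'a \<Rightarrow> bool) \<Rightarrow> 'a list \<Rightarrow> bool" where
  "is_cycle V E vs \<longleftrightarrow> length vs \<ge> 3 \<and> distinct vs \<and> set vs \<subseteq> V \<and>
     (\<forall>i < length vs. E (vs ! i) (vs ! ((i + 1) mod length vs)))"

definition cycle_edges :: "'a list \<Rightarrow> 'a set set" where
  "cycle_edges vs = {{vs ! i, vs ! ((i + 1) mod length vs)} | i. i < length vs}"

definition rainbow :: "('a set \<Rightarrow> 'c) \<Rightarrow> 'a list \<Rightarrow> bool" where
  "rainbow c vs \<longleftrightarrow> inj_on c (cycle_edges vs)"

definition crx :: "nat \<Rightarrow> 'a set \<Rightarrow> ('a \<Rightarrow> 'a \<Rightarrow> bool) \<Rightarrow> nat" where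
  "crx k V E = (LEAST m. \<exists>c :: 'a set \<Rightarrow> nat. card (c ` graph_edges V E) = m \<and>
      (\<forall>S \<subseteq> V. card S = k \<longrightarrow> (\<exists>vs. is_cycle V E vs \<and> S \<subseteq> set vs \<and> rainbow c vs)))"

text \<open>Complete t-partite graph with classes of sizes ns 0, ..., ns (t-1):
  vertex (i,j) is the j-th vertex of class i.\<close>
definition mp_verts :: "nat \<Rightarrow> (nat \<Rightarrow> nat) \<Rightarrow> (nat \<times> nat) set" where
  "mp_verts t ns = {(i, j). i < t \<and> j < ns i}"

definition mp_adj :: "nat \<times> nat \<Rightarrow> nat \<times> nat \<Rightarrow> bool" where
  "mp_adj u v \<longleftrightarrow> fst u \<noteq> fst v"

end

theory Submission
  imports Defs
begin

text \<open>
  An independent set of \<open>k\<close> vertices only lies on cycles of length at least \<open>2 * k\<close>, which gives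
  the lower bound in (b). For the upper bound it suffices to have a colouring with \<open>2 * k\<close> colours
  in which every class contains many vertices joined to two given vertices by edges of any
  prescribed colours: then a cycle of length \<open>2 * k\<close> through the given vertices can be completed
  greedily, one vertex at a time. Such a colouring is explicit. Give every vertex a distinct subset
  of \<open>{..<B}\<close> as its code, and let a label of \<open>x\<close> consist of an index \<open>b < B\<close> and two colours;
  \<open>x\<close> colours its edge to \<open>s\<close> by the first or the second colour, according to whether \<open>b\<close> lies in
  the code of \<open>s\<close>. Which end of an edge decides is settled by a further component of the labels,
  a vertex of the Paley tournament on seven points, in which any two points have a common
  in-neighbour. The number of labels is proportional to \<open>B\<close>, hence logarithmic in the number of
  vertices.
\<close>

subsection \<open>Colourings and cycles\<close>

text \<open>For the exhibited colouring an inequality suffices: it satisfies the premise of the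
  lower bound as well, which turns the inequality into an equality.\<close>

lemma crx_eqI:
  fixes c :: "'a set \<Rightarrow> nat"
  assumes "card (c ` graph_edges V E) \<le> m"
    and "\<And>S. S \<subseteq> V \<Longrightarrow> card S = k \<Longrightarrow> \<exists>vs. is_cycle V E vs \<and> S \<subseteq> set vs \<and> rainbow c vs"
    and lower: "\<And>c :: 'a set \<Rightarrow> nat.
      (\<And>S. S \<subseteq> V \<Longrightarrow> card S = k \<Longrightarrow> \<exists>vs. is_cycle V E vs \<and> S \<subseteq> set vs \<and> rainbow c vs) \<Longrightarrow>
      m \<le> card (c ` graph_edges V E)"
  shows "crx k V E = m"
proof -
  have "card (c ` graph_edges V E) = m"
    using assms(1) lower[of c] assms(2) by (simp add: le_antisym)
  then show ?thesis
    unfolding crx_def using assms(2) lower by (intro Least_equality) blast+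
qed

text \<open>Edges are unordered sets, so a rule in terms of two ends passes to edges by choosing an
  order of the ends; symmetry makes the choice immaterial.\<close>

lemma symmetric_colouring:
  fixes col :: "'a \<Rightarrow> 'a \<Rightarrow> 'c"
  assumes "\<And>u v. col u v = col v u"
  obtains c :: "'a set \<Rightarrow> 'c" where "\<And>u v. c {u, v} = col u v"
proof
  define c where "c e = (let p = SOME p. e = {fst p, snd p} in col (fst p) (snd p))" for e
  fix u v :: 'a
  define p where "p = (SOME p. {u, v} = {fst p, snd p})"
  have "{u, v} = {fst p, snd p}"
    unfolding p_def by (rule someI[of "\<lambda>p. {u, v} = {fst p, snd p}" "(u, v)"]) simp
  then have "col (fst p) (snd p) = col u v"
    using assms[of u v] by (auto simp: doubleton_eq_iff)
  then show "c {u, v} = col u v"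
    by (simp add: c_def p_def)
qed

section \<open>Cyclic successors and the lengths of rainbow cycles\<close>

lemma mod_succ_if:
  fixes i L :: nat
  assumes "i < L"
  shows "(i + 1) mod L = (if i + 1 = L then 0 else i + 1)"
  using assms by auto

lemma mod_succ_inj:
  fixes L :: nat
  assumes "Suc i mod L = Suc j mod L" "i < L" "j < L"
  shows "i = j"
  using assms by (auto simp: mod_if split: if_splits)

text \<open>Two different positions with the same edge would be cyclic successors of each other,
  which needs length 2 and is excluded by \<open>is_cycle\<close>.\<close>

lemma card_cycle_edges:
  assumes "is_cycle V E vs"
  shows "card (cycle_edges vs) = length vs"
proof -
  let ?L = "length vs"
  let ?e = "\<lambda>i. {vs ! i, vs ! ((i + 1) mod ?L)}"
  have L: "?L \<ge> 3" and d: "distinct vs"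
    using assms by (auto simp: is_cycle_def)
  have "inj_on ?e {..<?L}"
  proof (rule inj_onI)
    fix i j
    assume ij: "i \<in> {..<?L}" "j \<in> {..<?L}" and eq: "?e i = ?e j"
    have m: "(i + 1) mod ?L < ?L" for i
      using L by (intro mod_less_divisor) linarith
    have "i = j \<or> i = (j + 1) mod ?L \<and> (i + 1) mod ?L = j"
      using eq ij m d by (auto simp: doubleton_eq_iff nth_eq_iff_index_eq)
    then show "i = j"
      using ij L mod_succ_if[of i ?L] mod_succ_if[of j ?L]
      by (simp only: lessThan_iff split: if_splits) linarith+
  qed
  moreover have "cycle_edges vs = ?e ` {..<?L}"
    unfolding cycle_edges_def by auto
  ultimately show ?thesis
    by (simp add: card_image)
qed

text \<open>Source of both lower bounds. Finiteness of \<open>V\<close> matters because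
  \<open>card\<close> of an infinite set is 0.\<close>

lemma rainbow_cycle_length_le:
  assumes cyc: "is_cycle V E vs" and rb: "rainbow c vs" and "finite V"
  shows "length vs \<le> card (c ` graph_edges V E)"
proof -
  have sub: "cycle_edges vs \<subseteq> graph_edges V E"
  proof
    fix e assume "e \<in> cycle_edges vs"
    then obtain i where i: "i < length vs" "e = {vs ! i, vs ! ((i + 1) mod length vs)}"
      unfolding cycle_edges_def by auto
    then have "(i + 1) mod length vs < length vs"
      by (intro mod_less_divisor) auto
    then have "vs ! i \<in> V" "vs ! ((i + 1) mod length vs) \<in> V"
      "E (vs ! i) (vs ! ((i + 1) mod length vs))"
      using i(1) cyc unfolding is_cycle_def by (blast intro: nth_mem)+
    then show "e \<in> graph_edges V E"
      unfolding graph_edges_def i(2) by blast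
  qed
  have "finite (graph_edges V E)"
    by (rule finite_subset[of _ "Pow V"]) (use \<open>finite V\<close> in \<open>auto simp: graph_edges_def\<close>)
  then have "card (c ` cycle_edges vs) \<le> card (c ` graph_edges V E)"
    using sub by (intro card_mono) auto
  then show ?thesis
    using rb card_cycle_edges[OF cyc] by (simp add: rainbow_def card_image)
qed

text \<open>The cyclic successor of a position occupied by \<open>S\<close> is not occupied by
  \<open>S\<close>, so these positions and their shifts are disjoint and equally many.\<close>

lemma cycle_through_independent_set:
  assumes cyc: "is_cycle V E vs" and S: "S \<subseteq> set vs"
    and ind: "\<And>u v. u \<in> S \<Longrightarrow> v \<in> S \<Longrightarrow> \<not> E u v"
  shows "2 * card S \<le> length vs"
proof -
  let ?L = "length vs"
  let ?s = "\<lambda>i. (i + 1) mod ?L"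
  define I where "I = {i. i < ?L \<and> vs ! i \<in> S}"
  have fin: "finite I" unfolding I_def by auto
  have L: "?L \<ge> 3" using cyc by (auto simp: is_cycle_def)
  have "S = (!) vs ` I"
    using S unfolding I_def by (force simp: in_set_conv_nth)
  then have cS: "card S \<le> card I"
    using card_image_le[OF fin] by metis
  have inj: "inj_on ?s I"
    by (rule inj_onI) (auto simp: I_def intro: mod_succ_inj)
  have disj: "I \<inter> ?s ` I = {}"
  proof -
    have "vs ! ?s i \<notin> S" if "i \<in> I" for i
      using that cyc ind unfolding is_cycle_def I_def by blast
    then show ?thesis unfolding I_def by auto
  qed
  have "I \<union> ?s ` I \<subseteq> {..<?L}"
    using L by (auto simp: I_def intro!: mod_less_divisor)
  then have "card (I \<union> ?s ` I) \<le> ?L"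
    using card_mono[of "{..<?L}"] by fastforce
  moreover have "card (I \<union> ?s ` I) = 2 * card I"
    using fin disj inj by (simp add: card_Un_disjoint card_image)
  ultimately show ?thesis using cS by linarith
qed

text \<open>Describes a cycle by its positions, with colours indexed by positions too, so that
  rainbowness becomes injectivity of \<open>col\<close>.\<close>

lemma rainbow_cycle_of_fun:
  assumes L: "L \<ge> 3" and "inj_on g {..<L}" and "g ` {..<L} \<subseteq> V"
    and "\<And>i. i < L \<Longrightarrow> E (g i) (g ((i + 1) mod L))"
    and col: "\<And>i. i < L \<Longrightarrow> c {g i, g ((i + 1) mod L)} = col i"
    and inj: "inj_on col {..<L}"
  shows "is_cycle V E (map g [0..<L]) \<and> rainbow c (map g [0..<L])"
proof
  have m: "(i + 1) mod L < L" for i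
    using L by (intro mod_less_divisor) simp
  have nth: "map g [0..<L] ! i = g i" if "i < L" for i
    using that by simp
  show "is_cycle V E (map g [0..<L])"
    using assms m unfolding is_cycle_def
    by (auto simp: distinct_map atLeast0LessThan)
  have "cycle_edges (map g [0..<L]) = {{g i, g ((i + 1) mod L)} | i. i < L}"
    unfolding cycle_edges_def using m nth
    by (intro Collect_cong ex_cong1) auto
  also have "\<dots> = (\<lambda>i. {g i, g ((i + 1) mod L)}) ` {..<L}"
    by blast
  finally have edges: "cycle_edges (map g [0..<L]) = (\<lambda>i. {g i, g ((i + 1) mod L)}) ` {..<L}" .
  show "rainbow c (map g [0..<L])"
    unfolding rainbow_def edges
    by (rule inj_on_imageI) (use col inj in \<open>simp add: inj_on_def\<close>)
qed

lemma finite_mp_verts: "finite (mp_verts t ns)"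
  by (rule finite_subset[of _ "Sigma {..<t} (\<lambda>i. {..<ns i})"]) (auto simp: mp_verts_def)

lemma card_mp_verts_const: "card (mp_verts t (\<lambda>_. n)) = t * n"
proof -
  have "mp_verts t (\<lambda>_. n) = {..<t} \<times> {..<n}"
    by (auto simp: mp_verts_def)
  then show ?thesis by (simp add: card_cartesian_product)
qed

subsection \<open>Rainbow triangles\<close>

text \<open>Every vertex lies on a triangle meeting all three values of \<open>r\<close>, whose
  edges get the sums 0 + 1, 1 + 2 and 2 + 0, distinct modulo 3. Conversely, every cycle has at least
  three edges.\<close>

lemma crx_1_mp:
  fixes ns :: "nat \<Rightarrow> nat"
  assumes t: "t \<ge> 3" and pos: "\<And>i. i < t \<Longrightarrow> 1 \<le> ns i"
  shows "crx 1 (mp_verts t ns) mp_adj = 3"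
proof -
  \<comment> \<open>All classes from 2 onwards are merged into one group, so three groups remain for
    every \<open>t\<close>.\<close>
  define r where "r v = min 2 (fst v)" for v :: "nat \<times> nat"
  obtain c :: "(nat \<times> nat) set \<Rightarrow> nat" where c: "\<And>u v. c {u, v} = (r u + r v) mod 3"
    by (rule symmetric_colouring[of "\<lambda>u v. (r u + r v) mod 3"]) (auto simp: add.commute)
  show ?thesis
  proof (rule crx_eqI[of c])
    have "c ` graph_edges (mp_verts t ns) mp_adj \<subseteq> {..<3}"
      by (auto simp: graph_edges_def c)
    then show "card (c ` graph_edges (mp_verts t ns) mp_adj) \<le> 3"
      using card_mono[of "{..<3::nat}"] by fastforce
  next
    fix S assume "S \<subseteq> mp_verts t ns" "card S = 1"
    then obtain v where v: "S = {v}" "v \<in> mp_verts t ns"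
      by (auto simp: card_1_singleton_iff)
    \<comment> \<open>The corner of the triangle in group \<open>l\<close>: \<open>v\<close> in its
      own group, elsewhere the first vertex of class \<open>l\<close>, which exists since classes
      are nonempty.\<close>
    define f where "f l = (if r v = l then v else (l, 0))" for l :: nat
    have f: "f l \<in> mp_verts t ns" "r (f l) = l" if "l < 3" for l
      using that v(2) t pos[of l] by (auto simp: f_def r_def mp_verts_def)
    have ne: "fst (f l) \<noteq> fst (f l')" if "l < 3" "l' < 3" "l \<noteq> l'" for l l'
      using f(2)[OF that(1)] f(2)[OF that(2)] that(3) by (auto simp: r_def)
    have "is_cycle (mp_verts t ns) mp_adj (map f [0..<3]) \<and> rainbow c (map f [0..<3])"
    proof (rule rainbow_cycle_of_fun[where col = "\<lambda>i. (i + (i + 1) mod 3) mod 3"])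
      show "inj_on f {..<3}"
        by (rule inj_onI) (use ne in \<open>force\<close>)
      show "mp_adj (f i) (f ((i + 1) mod 3))" if "i < 3" for i
        unfolding mp_adj_def using that by (intro ne) (auto simp: mod_if)
      show "inj_on (\<lambda>i::nat. (i + (i + 1) mod 3) mod 3) {..<3}"
      proof -
        have "{..<3::nat} = {0, 1, 2}" by auto
        then show ?thesis by simp
      qed
    qed (use f in \<open>auto simp: c\<close>)
    moreover have "v \<in> f ` {0..<3}"
      by (rule image_eqI[of _ _ "r v"]) (auto simp: f_def r_def)
    ultimately show "\<exists>vs. is_cycle (mp_verts t ns) mp_adj vs \<and> S \<subseteq> set vs \<and> rainbow c vs"
      using v(1) by (intro exI[of _ "map f [0..<3]"]) auto
  next
    fix c :: "(nat \<times> nat) set \<Rightarrow> nat"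
    assume good: "\<And>S. S \<subseteq> mp_verts t ns \<Longrightarrow> card S = 1 \<Longrightarrow>
      \<exists>vs. is_cycle (mp_verts t ns) mp_adj vs \<and> S \<subseteq> set vs \<and> rainbow c vs"
    have "{(0, 0)} \<subseteq> mp_verts t ns"
      using t pos[of 0] by (auto simp: mp_verts_def)
    then obtain vs where vs: "is_cycle (mp_verts t ns) mp_adj vs" "rainbow c vs"
      using good[of "{(0, 0)}"] by auto
    have "3 \<le> length vs" using vs(1) by (simp add: is_cycle_def)
    also have "\<dots> \<le> card (c ` graph_edges (mp_verts t ns) mp_adj)"
      by (rule rainbow_cycle_length_le[OF vs finite_mp_verts])
    finally show "3 \<le> card (c ` graph_edges (mp_verts t ns) mp_adj)" .
  qed
qed

subsection \<open>A colouring with prescribed colours at pairs of vertices\<close>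

text \<open>1, 2 and 4 are the nonzero squares modulo 7. Adding 7 first keeps the subtraction of
  \<open>a < 7\<close> from being truncated at 0.\<close>

definition paley7 :: "nat \<Rightarrow> nat \<Rightarrow> bool" where
  "paley7 a b \<longleftrightarrow> (b + 7 - a) mod 7 \<in> {1, 2, 4}"

lemma paley7_asym:
  assumes "a < 7" "b < 7" "paley7 a b"
  shows "\<not> paley7 b a"
proof -
  have "\<forall>a\<in>set [0..<7]. \<forall>b\<in>set [0..<7]. paley7 a b \<longrightarrow> \<not> paley7 b a"
    unfolding paley7_def by code_simp
  moreover have "a \<in> set [0..<7]" "b \<in> set [0..<7]"
    using assms by auto
  ultimately show ?thesis using assms(3) by blast
qed

text \<open>Lets one new vertex decide the colours of its edges to two given vertices. Seven points
  are few enough to check all pairs by evaluation.\<close>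

lemma paley7_common_in_neighbour:
  assumes "b < 7" "b' < 7"
  obtains a where "a < 7" "paley7 a b" "paley7 a b'"
proof -
  have "\<forall>b\<in>set [0..<7]. \<forall>b'\<in>set [0..<7]. \<exists>a\<in>set [0..<7]. paley7 a b \<and> paley7 a b'"
    unfolding paley7_def by code_simp
  moreover have "b \<in> set [0..<7]" "b' \<in> set [0..<7]"
    using assms by auto
  ultimately obtain a where "a \<in> set [0..<7]" "paley7 a b" "paley7 a b'"
    by blast
  then show ?thesis using that by auto
qed

text \<open>The label of \<open>x\<close> is chosen so that its type dominates those of
  \<open>s\<close> and \<open>s'\<close> and its index lies in exactly one of their codes; its two
  colours are then the required ones in the right order. Each label occurs \<open>D\<close> times in
  each class, too often for \<open>X\<close> to contain all its copies.\<close>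

lemma pair_universal_colouring:
  fixes t n q B D :: nat
  defines "V \<equiv> mp_verts t (\<lambda>_. n)"
  assumes q: "0 < q" and B: "0 < B" and n: "7 * q * q * B * D \<le> n" and code: "t * n \<le> 2 ^ B"
  obtains c :: "(nat \<times> nat) set \<Rightarrow> nat"
  where "\<And>u v. u \<in> V \<Longrightarrow> v \<in> V \<Longrightarrow> c {u, v} < q"
    and "\<And>i s s' \<alpha> \<beta> X. i < t \<Longrightarrow> s \<in> V \<Longrightarrow> s' \<in> V \<Longrightarrow> \<alpha> < q \<Longrightarrow> \<beta> < q \<Longrightarrow>
      (s = s' \<Longrightarrow> \<alpha> = \<beta>) \<Longrightarrow> finite X \<Longrightarrow> card X < D \<Longrightarrow>
      \<exists>x \<in> V - X. fst x = i \<and> c {x, s} = \<alpha> \<and> c {x, s'} = \<beta>"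
proof -
  define P where "P = {..<7::nat} \<times> {..<q} \<times> {..<q} \<times> {..<B} \<times> {..<D}"
  have "card P \<le> card {..<n}"
    using n by (simp add: P_def card_cartesian_product mult.assoc)
  moreover have finP: "finite P" unfolding P_def by auto
  ultimately obtain enc where enc: "enc ` P \<subseteq> {..<n}" "inj_on enc P"
    using card_le_inj[of P "{..<n}"] by auto
  \<comment> \<open>The default label serves the vertices left over by \<open>enc\<close>; zeros
    keep types below 7 and colours below \<open>q\<close> there too.\<close>
  define dec where "dec j = (if j \<in> enc ` P then the_inv_into P enc j else (0, 0, 0, 0, 0))" for j
  have dec: "dec (enc p) = p" if "p \<in> P" for p
    using that enc by (auto simp: dec_def the_inv_into_f_f)
  define ty where "ty x = fst (dec (snd x))" for x :: "nat \<times> nat"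
  define col1 where "col1 x = fst (snd (dec (snd x)))" for x :: "nat \<times> nat"
  define col2 where "col2 x = fst (snd (snd (dec (snd x))))" for x :: "nat \<times> nat"
  define bit where "bit x = fst (snd (snd (snd (dec (snd x)))))" for x :: "nat \<times> nat"
  have ty: "ty x < 7" and col12: "col1 x < q" "col2 x < q" for x
    using the_inv_into_into[OF enc(2) _ subset_refl, of "snd x"] q
    by (auto simp: dec_def P_def ty_def col1_def col2_def)
  have "card V \<le> card (Pow {..<B})"
    using code by (simp add: V_def card_mp_verts_const card_Pow)
  then obtain code where code: "inj_on code V" "code ` V \<subseteq> Pow {..<B}"
    using card_le_inj[of V "Pow {..<B}"] finite_mp_verts unfolding V_def by blast
  define w where "w x s = (if bit x \<in> code s then col1 x else col2 x)" for x s
  \<comment> \<open>Asymmetry of the tournament makes this rule symmetric; the colour 0 is left for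
    ends of equal type.\<close>
  obtain c :: "(nat \<times> nat) set \<Rightarrow> nat"
    where c: "\<And>x s. c {x, s} = (if paley7 (ty x) (ty s) then w x s
                                else if paley7 (ty s) (ty x) then w s x else 0)"
    by (rule symmetric_colouring[of "\<lambda>x s. if paley7 (ty x) (ty s) then w x s
                                else if paley7 (ty s) (ty x) then w s x else 0"])
      (use ty paley7_asym in auto)
  show ?thesis
  proof
    show "c {u, v} < q" for u v
      using col12 q by (auto simp: c w_def)
  next
    fix i s s' \<alpha> \<beta> and X :: "(nat \<times> nat) set"
    assume i: "i < t" and s: "s \<in> V" "s' \<in> V" and \<alpha>\<beta>: "\<alpha> < q" "\<beta> < q"
      and same: "s = s' \<Longrightarrow> \<alpha> = \<beta>" and X: "finite X" "card X < D"
    obtain a where a: "a < 7" "paley7 a (ty s)" "paley7 a (ty s')"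
      using paley7_common_in_neighbour[OF ty ty] by blast
    \<comment> \<open>For \<open>s = s'\<close> any index works with both colours equal to \<alpha>;
      otherwise an index on which the two codes differ is taken.\<close>
    have "\<exists>b<B. \<exists>u<q. \<exists>v<q. (if b \<in> code s then u else v) = \<alpha> \<and> (if b \<in> code s' then u else v) = \<beta>"
    proof (cases "s = s'")
      case True
      then show ?thesis using same \<alpha>\<beta> B by auto
    next
      case False
      then obtain b where b: "b \<in> code s \<longleftrightarrow> b \<notin> code s'"
        using code(1) s by (auto simp: inj_on_def)
      then have "b < B" using code(2) s by blast
      then show ?thesis using b \<alpha>\<beta> by (intro exI[of _ b]) auto
    qed
    then obtain b u v where b: "b < B" "u < q" "v < q"
      "(if b \<in> code s then u else v) = \<alpha>" "(if b \<in> code s' then u else v) = \<beta>"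
      by blast
    \<comment> \<open>The component \<open>d\<close> has no influence on colours; it only makes
      \<open>D\<close> copies of the label.\<close>
    define f where "f d = (i, enc (a, u, v, b, d))" for d
    have P: "(a, u, v, b, d) \<in> P" if "d < D" for d
      using that a b by (auto simp: P_def)
    have "inj_on f {..<D}"
      using P enc(2) by (auto simp: inj_on_def f_def)
    then have "card (f ` {..<D}) = D"
      by (simp add: card_image)
    then have "\<not> f ` {..<D} \<subseteq> X"
      using X card_mono[of X "f ` {..<D}"] by auto
    then obtain d where d: "d < D" "f d \<notin> X" by blast
    have "f d \<in> V"
      using P[OF d(1)] enc(1) i by (auto simp: f_def V_def mp_verts_def)
    moreover have "c {f d, s} = \<alpha>" "c {f d, s'} = \<beta>"
      using a b dec[OF P[OF d(1)]]
      by (auto simp: c w_def ty_def col1_def col2_def bit_def f_def)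
    ultimately show "\<exists>x \<in> V - X. fst x = i \<and> c {x, s} = \<alpha> \<and> c {x, s'} = \<beta>"
      using d(2) by (intro bexI[of _ "f d"]) (auto simp: f_def)
  qed
qed

text \<open>Guarantees enough codes: the number of vertices will be at most linear in
  \<open>B\<close>, while there are \<open>2 ^ B\<close> subsets of \<open>{..<B}\<close>.\<close>

lemma linear_le_power2:
  fixes K m :: nat
  assumes "2 * K \<le> m"
  shows "K * (m + 1) \<le> 2 ^ m"
  using assms
proof (induction m rule: dec_induct)
  case base
  have "K * (2 * K + 1) \<le> 4 ^ K"
  proof (induction K)
    case (Suc K)
    \<comment> \<open>Growth by a factor of at most 4 fails only at \<open>K = 0\<close>, where the
      left side is 3; hence the correction term.\<close>
    have "Suc K * (2 * Suc K + 1) \<le> 4 * (K * (2 * K + 1)) + (if K = 0 then 3 else 0)"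
      by (cases K) (auto simp: algebra_simps)
    then show ?case using Suc by (cases "K = 0") auto
  qed simp
  then show ?case by (simp add: power_mult)
next
  case (step m)
  have "K * (Suc m + 1) \<le> 2 * (K * (m + 1))" by (simp add: algebra_simps)
  then show ?case using step.IH by simp
qed

subsection \<open>Completing a partial cycle\<close>

text \<open>An empty position has at most two filled neighbours, and fewer than \<open>L\<close>
  vertices are placed before it is filled, so \<open>ext\<close> always supplies a new vertex of
  class \<open>p i\<close> with the right colours on the edges to those neighbours.\<close>

lemma complete_rainbow_cycle:
  fixes t n k :: nat
  defines "V \<equiv> mp_verts t (\<lambda>_. n)" and "L \<equiv> 2 * k"
  assumes k: "k \<ge> 2"
    and cq: "\<And>u v. u \<in> V \<Longrightarrow> v \<in> V \<Longrightarrow> c {u, v} < L"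
    and ext: "\<And>i s s' \<alpha> \<beta> X. i < t \<Longrightarrow> s \<in> V \<Longrightarrow> s' \<in> V \<Longrightarrow> \<alpha> < L \<Longrightarrow> \<beta> < L \<Longrightarrow>
      (s = s' \<Longrightarrow> \<alpha> = \<beta>) \<Longrightarrow> finite X \<Longrightarrow> card X < L \<Longrightarrow>
      \<exists>x \<in> V - X. fst x = i \<and> c {x, s} = \<alpha> \<and> c {x, s'} = \<beta>"
    and p: "\<And>i. i < L \<Longrightarrow> p i < t" "\<And>i. i < L \<Longrightarrow> p i \<noteq> p ((i + 1) mod L)"
    and F: "F \<subseteq> {..<L}" "F \<noteq> {}" "\<And>i. i \<in> F \<Longrightarrow> Suc i \<notin> F"
    and g: "inj_on g F" "g ` F \<subseteq> V" "\<And>i. i \<in> F \<Longrightarrow> fst (g i) = p i"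
  shows "\<exists>vs. is_cycle V mp_adj vs \<and> g ` F \<subseteq> set vs \<and> rainbow c vs"
proof -
  have L: "L \<ge> 4" using k by (simp add: L_def)
  have m: "(i + 1) mod L < L" for i
    using L by (intro mod_less_divisor) simp
  text \<open>The shift makes the colour of the only edge that may already be present the right one.\<close>
  define col where "col i = (c {g (L - 1), g 0} + 1 + i) mod L" for i
  have col_less: "col i < L" for i
    unfolding col_def using L by (intro mod_less_divisor) simp
  have col_inj: "inj_on col {..<L}"
  proof (rule linorder_inj_onI')
    fix i j assume ij: "i \<in> {..<L}" "j \<in> {..<L}" "i < j"
    show "col i \<noteq> col j"
    proof
      assume "col i = col j"
      then have "L dvd (c {g (L - 1), g 0} + 1 + j) - (c {g (L - 1), g 0} + 1 + i)"
        unfolding col_def by (metis mod_eq_dvd_iff_nat add_le_cancel_left ij(3) less_imp_le)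
      then have "L dvd j - i" by simp
      then show False using ij by (auto dest: dvd_imp_le)
    qed
  qed
  \<comment> \<open>Colours are demanded only of edges with both ends placed.\<close>
  define inv where "inv h A \<longleftrightarrow> inj_on h A \<and> h ` A \<subseteq> V \<and> (\<forall>i\<in>A. fst (h i) = p i) \<and>
    (\<forall>i\<in>A. (i + 1) mod L \<in> A \<longrightarrow> c {h i, h ((i + 1) mod L)} = col i)" for h A
  have base: "inv g F"
  proof -
    have "c {g i, g ((i + 1) mod L)} = col i" if "i \<in> F" "(i + 1) mod L \<in> F" for i
    proof -
      have "i < L" using that F(1) by auto
      \<comment> \<open>The condition on \<open>F\<close> does not wrap around, so the only edge
        with both ends in \<open>F\<close> can be the one from \<open>L - 1\<close> to
        \<open>0\<close>.\<close>
      moreover have "\<not> i + 1 < L" using that F(3)[of i] by auto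
      ultimately have i: "i = L - 1" by simp
      then have i1: "(i + 1) mod L = 0" using L by simp
      have "c {g (L - 1), g 0} < L"
        using that i i1 g(2) by (intro cq) auto
      moreover have "c {g (L - 1), g 0} + 1 + (L - 1) = c {g (L - 1), g 0} + L"
        using L by simp
      ultimately have "col i = c {g (L - 1), g 0}"
        unfolding col_def i by (simp only: mod_add_self2 mod_less)
      then show ?thesis using i i1 by simp
    qed
    then show ?thesis using g unfolding inv_def by blast
  qed
  \<comment> \<open>Induction over the positions to be filled, in any order; taking \<open>G\<close>
    to be all positions gives the full cycle.\<close>
  have "\<exists>h. inv h (F \<union> G) \<and> (\<forall>i\<in>F. h i = g i)" if "finite G" "G \<subseteq> {..<L}" for G
    using that
  proof (induction G rule: finite_induct)
    case empty
    then show ?case using base by auto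
  next
    case (insert j G)
    let ?A = "F \<union> G"
    from insert obtain h where h: "inv h ?A" "\<forall>i\<in>F. h i = g i" by auto
    have A: "?A \<subseteq> {..<L}" "finite ?A" and j: "j < L"
      using insert F(1) finite_subset by auto
    show ?case
    proof (cases "j \<in> ?A")
      case True
      then have "F \<union> insert j G = ?A" by auto
      then show ?thesis using h by auto
    next
      case False
      define pr where "pr = (if j = 0 then L - 1 else j - 1)"
      define nx where "nx = (j + 1) mod L"
      have pr: "pr < L" "(pr + 1) mod L = j" and uniq: "\<And>i. i < L \<Longrightarrow> (i + 1) mod L = j \<Longrightarrow> i = pr"
        using j L by (auto simp: pr_def mod_if split: if_splits)
      have ne: "pr \<noteq> nx" "pr \<noteq> j" "nx \<noteq> j"
        using j L by (auto simp: pr_def nx_def mod_if split: if_splits)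
      have cardA: "card ?A < L"
      proof -
        have "?A \<subset> {..<L}" using A False j by auto
        then have "card ?A < card {..<L}" by (intro psubset_card_mono) simp
        then show ?thesis by simp
      qed
      have V: "h i \<in> V" if "i \<in> ?A" for i
        using h(1) that unfolding inv_def by blast
      \<comment> \<open>A dummy neighbour for the case in which neither real neighbour is
        placed.\<close>
      obtain e where e: "e \<in> ?A" using F(2) by auto
      have "\<exists>x \<in> V - h ` ?A. fst x = p j \<and> (pr \<in> ?A \<longrightarrow> c {x, h pr} = col pr) \<and>
              (nx \<in> ?A \<longrightarrow> c {x, h nx} = col j)"
      proof -
        have X: "finite (h ` ?A)" "card (h ` ?A) < L"
          using A(2) cardA card_image_le[of ?A h] by auto
        have ex: "\<exists>x \<in> V - h ` ?A. fst x = p j \<and> c {x, s} = \<alpha> \<and> c {x, s'} = \<beta>"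
          if "s \<in> V" "s' \<in> V" "\<alpha> < L" "\<beta> < L" "s = s' \<Longrightarrow> \<alpha> = \<beta>" for s s' \<alpha> \<beta>
          using ext[OF p(1)[OF j] that X] by blast
        \<comment> \<open>\<open>ext\<close> always expects two vertices: if only one neighbour is
          placed, it is given twice with the same colour.\<close>
        consider "pr \<in> ?A" "nx \<in> ?A" | "pr \<in> ?A" "nx \<notin> ?A" | "pr \<notin> ?A" "nx \<in> ?A"
          | "pr \<notin> ?A" "nx \<notin> ?A" by blast
        then show ?thesis
        proof cases
          case 1
          then have "h pr \<noteq> h nx"
            using h(1) ne(1) unfolding inv_def by (auto dest: inj_onD)
          then show ?thesis
            using ex[of "h pr" "h nx" "col pr" "col j"] V 1 col_less by blast
        next
          case 2
          then show ?thesis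
            using ex[of "h pr" "h pr" "col pr" "col pr"] V col_less by blast
        next
          case 3
          then show ?thesis
            using ex[of "h nx" "h nx" "col j" "col j"] V col_less by blast
        next
          case 4
          then show ?thesis
            using ex[of "h e" "h e" "col j" "col j"] V e col_less by blast
        qed
      qed
      then obtain x where x: "x \<in> V" "x \<notin> h ` ?A" "fst x = p j"
        "pr \<in> ?A \<Longrightarrow> c {x, h pr} = col pr" "nx \<in> ?A \<Longrightarrow> c {x, h nx} = col j"
        by blast
      let ?h = "h(j := x)"
      have eq: "?h i = h i" if "i \<in> ?A" for i
        using that False by auto
      have "inj_on ?h (insert j ?A)"
        using h(1) x(2) False unfolding inv_def by (auto simp: inj_on_def)
      moreover have "?h ` insert j ?A \<subseteq> V" "\<forall>i\<in>insert j ?A. fst (?h i) = p i"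
        using h(1) x V unfolding inv_def by auto
      moreover have "c {?h i, ?h ((i + 1) mod L)} = col i"
        if i: "i \<in> insert j ?A" "(i + 1) mod L \<in> insert j ?A" for i
      proof -
        consider "i = j" | "i \<in> ?A" "(i + 1) mod L = j" | "i \<in> ?A" "(i + 1) mod L \<in> ?A"
          using i ne(3) by blast
        then show ?thesis
        proof cases
          case 1
          then show ?thesis using i x(5) ne(3) unfolding nx_def by auto
        next
          case 2
          then have "i = pr" using uniq A(1) by auto
          then show ?thesis using 2 x(4) ne(2) pr(2) by (auto simp: insert_commute)
        next
          case 3
          then show ?thesis using h(1) eq unfolding inv_def by metis
        qed
      qed
      ultimately have "inv ?h (insert j ?A)"
        unfolding inv_def by blast
      moreover have "\<forall>i\<in>F. ?h i = g i"
        using h(2) eq by auto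
      ultimately show ?thesis by (metis Un_insert_right)
    qed
  qed
  from this[of "{..<L}"] F(1) obtain h where h: "inv h {..<L}" "\<forall>i\<in>F. h i = g i"
    by (auto simp: Un_absorb1)
  have "is_cycle V mp_adj (map h [0..<L]) \<and> rainbow c (map h [0..<L])"
  proof (rule rainbow_cycle_of_fun[OF _ _ _ _ _ col_inj])
    show "mp_adj (h i) (h ((i + 1) mod L))" if "i < L" for i
      using h(1) p(2) that m unfolding inv_def mp_adj_def by auto
  qed (use L h(1) m in \<open>auto simp: inv_def\<close>)
  moreover have "g ` F \<subseteq> set (map h [0..<L])"
    using h(2) F(1) by (force simp: image_iff)
  ultimately show ?thesis by blast
qed

text \<open>
  Two consecutive vertices of \<open>S\<close> are separated by one new vertex. With only two classes this is
  impossible at a change of class, so then the vertices of class 0 come first and sit at even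
  positions, and those of class 1 follow at odd positions.
\<close>

lemma partial_cycle:
  fixes t n k :: nat
  assumes t: "t \<ge> 2" and k: "k \<ge> 2" and S: "S \<subseteq> mp_verts t (\<lambda>_. n)" "card S = k"
  obtains F p and g :: "nat \<Rightarrow> nat \<times> nat"
  where "F \<subseteq> {..<2 * k}" "\<And>i. i \<in> F \<Longrightarrow> Suc i \<notin> F" "inj_on g F" "g ` F = S"
    and "\<And>i. i \<in> F \<Longrightarrow> fst (g i) = p i"
    and "\<And>i. i < 2 * k \<Longrightarrow> p i < t" "\<And>i. i < 2 * k \<Longrightarrow> p i \<noteq> p ((i + 1) mod (2 * k))"
proof -
  have fin: "finite S" using S finite_mp_verts finite_subset by blast
  have less_t: "fst s < t" if "s \<in> S" for s
    using that S by (auto simp: mp_verts_def)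
  \<comment> \<open>One position of each pair \<open>2 * i\<close>, \<open>2 * i + 1\<close>: the
    even one for \<open>i < a\<close>, the odd one from then on. The single switch from even to odd
    only widens a gap.\<close>
  define F where "F a = {j. j < 2 * k \<and> (even j \<longleftrightarrow> j div 2 < a)}" for a
  have F: "F a \<subseteq> {..<2 * k}" "\<And>i. i \<in> F a \<Longrightarrow> Suc i \<notin> F a" for a
    by (auto simp: F_def elim!: evenE oddE)
  have bij: "bij_betw (\<lambda>j. j div 2) (F a) {..<k}" for a
    by (rule bij_betw_byWitness[where f' = "\<lambda>i. if i < a then 2 * i else 2 * i + 1"])
      (auto simp: F_def elim!: evenE oddE, presburger)
  have Sbij: "bij_betw (\<lambda>j. xs ! (j div 2)) (F a) S" if "distinct xs" "set xs = S" for xs a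
  proof -
    have "length xs = k" using that S(2) distinct_card by metis
    then have "bij_betw ((!) xs) {..<k} S"
      using that by (intro bij_betw_nth) auto
    then show ?thesis using bij_betw_trans[OF bij] by (simp add: comp_def)
  qed
  show ?thesis
  proof (cases "t = 2")
    case True
    obtain xs where xs: "distinct xs" "set xs = {s\<in>S. fst s = 0}"
      using finite_distinct_list[of "{s\<in>S. fst s = 0}"] fin by auto
    obtain ys where ys: "distinct ys" "set ys = {s\<in>S. fst s \<noteq> 0}"
      using finite_distinct_list[of "{s\<in>S. fst s \<noteq> 0}"] fin by auto
    \<comment> \<open>Switching parity after the vertices of class 0 makes the class of each vertex
      agree with the parity of its position.\<close>
    let ?a = "length xs"
    let ?g = "\<lambda>j. (xs @ ys) ! (j div 2)"
    have b: "bij_betw ?g (F ?a) S"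
      using xs ys by (intro Sbij) auto
    show ?thesis
    proof (rule that[of "F ?a" ?g "\<lambda>i. i mod 2"])
      fix i assume i: "i \<in> F ?a"
      have "distinct (xs @ ys)" "set (xs @ ys) = S"
        using xs ys by auto
      then have len: "length (xs @ ys) = k"
        using S(2) distinct_card by metis
      show "fst (?g i) = i mod 2"
      proof (cases "i div 2 < ?a")
        case True
        then show ?thesis
          using i xs nth_mem[OF True] by (auto simp: F_def nth_append)
      next
        case False
        then have "i div 2 - ?a < length ys" using i len by (auto simp: F_def)
        then have "ys ! (i div 2 - ?a) \<in> set ys" by (rule nth_mem)
        then have "fst (ys ! (i div 2 - ?a)) \<noteq> 0" "fst (ys ! (i div 2 - ?a)) < 2"
          using ys(2) less_t \<open>t = 2\<close> by blast+
        then have "fst (ys ! (i div 2 - ?a)) = 1"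
          by linarith
        then show ?thesis
          using i False by (auto simp: F_def nth_append odd_iff_mod_2_eq_one)
      qed
    next
      fix i assume "i < 2 * k"
      have "(i + 1) mod (2 * k) mod 2 = (i + 1) mod 2"
        by (simp add: mod_mod_cancel)
      moreover have "i mod 2 \<noteq> (i + 1) mod 2"
        by presburger
      ultimately show "i mod 2 \<noteq> (i + 1) mod (2 * k) mod 2"
        by metis
    qed (use F b t in \<open>auto simp: bij_betw_def\<close>)
  next
    case False
    have "\<exists>z<t. z \<noteq> x \<and> z \<noteq> y" for x y :: nat
    proof -
      have "\<not> {..<t} \<subseteq> {x, y}"
      proof
        assume "{..<t} \<subseteq> {x, y}"
        then have "t \<le> card {x, y}" using card_mono[of "{x, y}" "{..<t}"] by simp
        then show False using False t by (auto simp: card_insert_if split: if_splits)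
      qed
      then show ?thesis by auto
    qed
    then obtain z where z: "\<And>x y. z x y < t \<and> z x y \<noteq> x \<and> z x y \<noteq> y"
      by metis
    obtain xs where xs: "distinct xs" "set xs = S"
      using finite_distinct_list[OF fin] by auto
    have len: "length xs = k" using xs S(2) distinct_card by metis
    let ?g = "\<lambda>j. xs ! (j div 2)"
    let ?q = "\<lambda>i. fst (xs ! i)"
    \<comment> \<open>With \<open>a = k\<close> exactly the even positions are occupied; each odd
      one gets a class different from those of its two neighbours, the last wrapping around to the
      first.\<close>
    let ?p = "\<lambda>j. if even j then ?q (j div 2) else z (?q (j div 2)) (?q ((j div 2 + 1) mod k))"
    have b: "bij_betw ?g (F k) S"
      using xs by (intro Sbij)
    show ?thesis
    proof (rule that[of "F k" ?g ?p])
      fix i assume i: "i < 2 * k"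
      then have "i div 2 < k" by auto
      then have "xs ! (i div 2) \<in> S" using len xs(2) nth_mem by metis
      then show "?p i < t" using z less_t by auto
      show "?p i \<noteq> ?p ((i + 1) mod (2 * k))"
      proof (cases "even i")
        case True
        then obtain j where j: "i = 2 * j" by (rule evenE)
        then have "(i + 1) mod (2 * k) = 2 * j + 1" using i by simp
        then show ?thesis
          using z[of "?q j" "?q ((j + 1) mod k)"] unfolding j by simp
      next
        case False
        then obtain j where j: "i = 2 * j + 1" by (rule oddE)
        have "(i + 1) mod (2 * k) = 2 * ((j + 1) mod k)"
          unfolding j by (simp add: mult_mod_right)
        then show ?thesis
          using z[of "?q j" "?q ((j + 1) mod k)"] unfolding j by simp
      qed
    qed (use F b in \<open>auto simp: bij_betw_def F_def\<close>)
  qed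
qed

subsection \<open>The upper bound meets the lower bound\<close>

lemma crx_balanced_mp:
  assumes k: "k \<ge> 2" and t: "t \<ge> 2"
  shows "\<exists>N. \<forall>n \<ge> N. crx k (mp_verts t (\<lambda>_. n)) mp_adj = 2 * k"
proof -
  define q where "q = 2 * k"
  \<comment> \<open>\<open>C * B\<close> is the number of labels for \<open>D = q\<close> copies, as
    many as the completion of a cycle of length \<open>q\<close> needs.\<close>
  define C where "C = 7 * q * q * q"
  have q: "q > 0" and C: "C > 0" using k by (auto simp: q_def C_def)
  \<comment> \<open>The threshold yields \<open>B \<ge> 2 * (t * C) + k\<close>: the first summand
    makes room for the codes, the second ensures \<open>B > 0\<close> and
    \<open>n \<ge> k\<close>.\<close>
  have "crx k (mp_verts t (\<lambda>_. n)) mp_adj = 2 * k" if n: "n \<ge> C * (2 * (t * C) + k)" for n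
  proof -
    define B where "B = n div C"
    have B: "B \<ge> 2 * (t * C) + k"
      using n C unfolding B_def by (metis div_le_mono nonzero_mult_div_cancel_left neq0_conv)
    have nk: "n \<ge> k"
      using B k div_le_dividend[of n C] unfolding B_def by linarith
    have "7 * q * q * B * q = C * B" by (simp add: C_def)
    also have "\<dots> \<le> n" unfolding B_def by simp
    finally have CB: "7 * q * q * B * q \<le> n" .
    have "n < C * (B + 1)"
      using C dividend_less_times_div[of C n] by (simp add: B_def)
    then have "t * n \<le> (t * C) * (B + 1)"
      using mult_le_mono2[of n "C * (B + 1)" t] by (simp only: mult.assoc less_imp_le)
    also have "\<dots> \<le> 2 ^ B"
      using B by (intro linear_le_power2) simp
    finally have code: "t * n \<le> 2 ^ B" .
    have "B > 0" using B k by simp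
    let ?V = "mp_verts t (\<lambda>_. n)"
    from pair_universal_colouring[OF q \<open>B > 0\<close> CB code]
    obtain c :: "(nat \<times> nat) set \<Rightarrow> nat" where cq: "\<And>u v. u \<in> ?V \<Longrightarrow> v \<in> ?V \<Longrightarrow> c {u, v} < q"
      and ext: "\<And>i s s' \<alpha> \<beta> X. i < t \<Longrightarrow> s \<in> ?V \<Longrightarrow> s' \<in> ?V \<Longrightarrow> \<alpha> < q \<Longrightarrow> \<beta> < q \<Longrightarrow>
        (s = s' \<Longrightarrow> \<alpha> = \<beta>) \<Longrightarrow> finite X \<Longrightarrow> card X < q \<Longrightarrow>
        \<exists>x \<in> ?V - X. fst x = i \<and> c {x, s} = \<alpha> \<and> c {x, s'} = \<beta>"
      by blast
    show ?thesis
    proof (rule crx_eqI[of c])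
      have "c ` graph_edges ?V mp_adj \<subseteq> {..<q}"
        using cq by (auto simp: graph_edges_def)
      then show "card (c ` graph_edges ?V mp_adj) \<le> 2 * k"
        using card_mono[of "{..<q}"] unfolding q_def by fastforce
    next
      fix S assume S: "S \<subseteq> ?V" "card S = k"
      obtain F p g where Fpg: "F \<subseteq> {..<2 * k}" "\<And>i. i \<in> F \<Longrightarrow> Suc i \<notin> F" "inj_on g F"
          "\<And>i. i \<in> F \<Longrightarrow> fst (g i) = p i" "\<And>i. i < 2 * k \<Longrightarrow> p i < t"
          "\<And>i. i < 2 * k \<Longrightarrow> p i \<noteq> p ((i + 1) mod (2 * k))"
        and g: "g ` F = S"
        by (rule partial_cycle[OF t k S]) blast
      have "F \<noteq> {}" using g S(2) k by auto
      then show "\<exists>vs. is_cycle ?V mp_adj vs \<and> S \<subseteq> set vs \<and> rainbow c vs"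
        using complete_rainbow_cycle[OF k cq[unfolded q_def] ext[unfolded q_def] Fpg(5,6,1) _ Fpg(2,3) _ Fpg(4)]
          S(1) unfolding g by blast
    next
      fix c :: "(nat \<times> nat) set \<Rightarrow> nat"
      assume good: "\<And>S. S \<subseteq> ?V \<Longrightarrow> card S = k \<Longrightarrow>
        \<exists>vs. is_cycle ?V mp_adj vs \<and> S \<subseteq> set vs \<and> rainbow c vs"
      \<comment> \<open>An independent set of \<open>k\<close> vertices in class 0 forces a cycle of
        length at least \<open>2 * k\<close>.\<close>
      let ?S = "{0::nat} \<times> {..<k}"
      have "?S \<subseteq> ?V" "card ?S = k"
        using t nk by (auto simp: mp_verts_def card_cartesian_product)
      then obtain vs where vs: "is_cycle ?V mp_adj vs" "?S \<subseteq> set vs" "rainbow c vs"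
        using good by blast
      have "2 * card ?S \<le> length vs"
        by (rule cycle_through_independent_set[OF vs(1,2)]) (auto simp: mp_adj_def)
      then show "2 * k \<le> card (c ` graph_edges ?V mp_adj)"
        using rainbow_cycle_length_le[OF vs(1,3) finite_mp_verts] \<open>card ?S = k\<close> by linarith
    qed
  qed
  then show ?thesis by blast
qed

theorem theorem3p4:
  shows "(\<forall>t (ns :: nat \<Rightarrow> nat). t \<ge> 3 \<longrightarrow> 1 \<le> ns 0 \<longrightarrow>
            (\<forall>i j. i \<le> j \<longrightarrow> j < t \<longrightarrow> ns i \<le> ns j) \<longrightarrow>
            crx 1 (mp_verts t ns) mp_adj = 3)
       \<and> (\<forall>k t :: nat. k \<ge> 2 \<longrightarrow> t \<ge> 2 \<longrightarrow>
            (\<exists>N. \<forall>n \<ge> N. crx k (mp_verts t (\<lambda>_. n)) mp_adj = 2 * k))"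
proof (intro conjI allI impI)
  fix t :: nat and ns :: "nat \<Rightarrow> nat"
  assume "t \<ge> 3" "1 \<le> ns 0" "\<forall>i j. i \<le> j \<longrightarrow> j < t \<longrightarrow> ns i \<le> ns j"
  then show "crx 1 (mp_verts t ns) mp_adj = 3"
    by (intro crx_1_mp) (auto intro: order_trans)
qed (rule crx_balanced_mp)

end
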